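(* Let $F(x,t)=\gamma(x)+t\xi(x)$ be a $k$-th pseudo cylindrical developable surface with associated functions $q,\delta$ and signed area density $\lambda$ as in the context, and write $q(x)=\tilde q(x)x^{Q}$ with $Q\in\mathbb{Z}_{\ge0}$ and $\tilde q$ real analytic, where $\tilde q(0)\neq 0$ in case $k\ge Q$. (1) Suppose $k>Q\ge 1$. Then, for every $t\in\mathbb{R}$, the singular point $(0,t)$ of $F$ is non-degenerate if and only if $Q=1$. (2) Suppose $Q\ge k$, and let $t(x)=-\dfrac{\tilde q(x)}{\|\tilde\xi(x)\|}x^{Q-k}$ be the analytic extension of $-q(x)/\delta(x)$. Then the singular point $(0,t(0))$ of $F$ is non-degenerate if and only if $\delta(0)\ne 0$, and it is degenerate if and only if $\delta(0)=0$.
   Context: Let $I\subset\mathbb{R}$ be an open interval containing $0$ (all statements are local at $x=0$, so $I$ may be shrunk), and let $\gamma:I\to\mathbb{R}^3$ with $\gamma(0)=0$ and $\xi:I\to S^2$ be real analytic. The ruled surface is $F:I\times\mathbb{R}\to\mathbb{R}^3$, $F(x,t)=\gamma(x)+t\xi(x)$. It is called $k$-th pseudo cylindrical ($k\in\mathbb{Z}_{\ge 0}$) if $\xi'(x)=\tilde\xi(x)x^{k}$ with $\tilde\xi(0)\neq\mathbf 0$; $I$ is taken so small that $\tilde\xi$ has no zeros on $I$. Put $\xi_d=\tilde\xi/\|\tilde\xi\|$, so $\{\xi,\xi_d,\xi\times\xi_d\}$ is an orthonormal frame, and $\delta(x)=\langle\xi'(x),\xi_d(x)\rangle=\|\tilde\xi(x)\|x^{k}$.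 The functions $p,q,r:I\to\mathbb{R}$ are defined by $\gamma'=p\,\xi+q\,\xi_d+r\,(\xi\times\xi_d)$. $F$ is a developable surface (vanishing Gaussian curvature on the regular part), equivalently $r\equiv 0$. For such $F$ the unit normal vector field is $\nu(x)=\xi(x)\times\xi_d(x)$, and the signed area density is $\lambda=\det(F_x,F_t,\nu)=-(q(x)+t\delta(x))$. A point is singular if $\operatorname{rank} dF<2$ there, equivalently $\lambda=0$. A singular point $p_0$ is called non-degenerate if $d\lambda(p_0)\neq 0$ and degenerate if $d\lambda(p_0)=0$. *)

theory Defs
  imports "HOL-Analysis.Analysis"
begin

text \<open>
  Real analyticity of a curve, expressed componentwise: around every point of the set each
  component is the sum of a power series with positive radius of convergence.
\<close>

definition real_analytic_on :: "(real \<Rightarrow> 'a::euclidean_space) \<Rightarrow> real set \<Rightarrow> bool" where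
  "real_analytic_on f S \<longleftrightarrow>
     (\<forall>x\<in>S. \<forall>b\<in>Basis. \<exists>A. (\<lambda>h. f (x + h) \<bullet> b) has_fps_expansion A)"

definition partial_x :: "(real \<times> real \<Rightarrow> 'a::real_normed_vector) \<Rightarrow> real \<times> real \<Rightarrow> 'a" where
  "partial_x F p = vector_derivative (\<lambda>s. F (s, snd p)) (at (fst p))"

definition partial_t :: "(real \<times> real \<Rightarrow> 'a::real_normed_vector) \<Rightarrow> real \<times> real \<Rightarrow> 'a" where
  "partial_t F p = vector_derivative (\<lambda>s. F (fst p, s)) (at (snd p))"

definition differential ::
  "(real \<times> real \<Rightarrow> 'a::real_normed_vector) \<Rightarrow> real \<times> real \<Rightarrow> real \<times> real \<Rightarrow> 'a" where
  "differential F p = frechet_derivative F (at p)"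

definition singular_point :: "(real \<times> real \<Rightarrow> real^3) \<Rightarrow> real \<times> real \<Rightarrow> bool" where
  "singular_point F p \<longleftrightarrow> dim (range (differential F p)) < 2"

text \<open>
  The usual \<open>(LN - M\<^sup>2) / (EG - F\<^sup>2)\<close>; only meaningful where \<open>F\<close> is regular.
\<close>

definition gaussian_curvature :: "(real \<times> real \<Rightarrow> real^3) \<Rightarrow> real \<times> real \<Rightarrow> real" where
  "gaussian_curvature F p =
     (let Fx = partial_x F p; Ft = partial_t F p;
          n = (1 / norm (cross3 Fx Ft)) *\<^sub>R cross3 Fx Ft;
          L = partial_x (partial_x F) p \<bullet> n;
          M = partial_x (partial_t F) p \<bullet> n;
          N = partial_t (partial_t F) p \<bullet> n
      in (L * N - M\<^sup>2) / ((Fx \<bullet> Fx) * (Ft \<bullet> Ft) - (Fx \<bullet> Ft)\<^sup>2))"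

definition ruled_surface ::
  "(real \<Rightarrow> real^3) \<Rightarrow> (real \<Rightarrow> real^3) \<Rightarrow> real \<times> real \<Rightarrow> real^3" where
  "ruled_surface \<gamma> \<xi> = (\<lambda>(x, t). \<gamma> x + t *\<^sub>R \<xi> x)"

definition developable_on :: "real set \<Rightarrow> (real \<times> real \<Rightarrow> real^3) \<Rightarrow> bool" where
  "developable_on I F \<longleftrightarrow>
     (\<forall>x\<in>I. \<forall>t. \<not> singular_point F (x, t) \<longrightarrow> gaussian_curvature F (x, t) = 0)"

text \<open>
  \<open>\<zeta>\<close> is the analytic factor with \<open>\<xi>' = x\<^sup>k \<zeta>\<close>. Its analyticity has to be required: for \<open>k > 0\<close>
  the equation alone does not determine \<open>\<zeta> 0\<close>. The interval is small enough that \<open>\<zeta>\<close> has no zero.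
\<close>

definition pseudo_cylindrical ::
  "real set \<Rightarrow> nat \<Rightarrow> (real \<Rightarrow> real^3) \<Rightarrow> (real \<Rightarrow> real^3) \<Rightarrow> bool" where
  "pseudo_cylindrical I k \<xi> \<zeta> \<longleftrightarrow>
     real_analytic_on \<zeta> I \<and>
     (\<forall>x\<in>I. vector_derivative \<xi> (at x) = x ^ k *\<^sub>R \<zeta> x) \<and>
     (\<forall>x\<in>I. \<zeta> x \<noteq> 0)"

definition xi_d :: "(real \<Rightarrow> real^3) \<Rightarrow> real \<Rightarrow> real^3" where
  "xi_d \<zeta> x = (1 / norm (\<zeta> x)) *\<^sub>R \<zeta> x"

definition delta :: "(real \<Rightarrow> real^3) \<Rightarrow> (real \<Rightarrow> real^3) \<Rightarrow> real \<Rightarrow> real" where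
  "delta \<xi> \<zeta> x = vector_derivative \<xi> (at x) \<bullet> xi_d \<zeta> x"

definition unit_normal :: "(real \<Rightarrow> real^3) \<Rightarrow> (real \<Rightarrow> real^3) \<Rightarrow> real \<times> real \<Rightarrow> real^3" where
  "unit_normal \<xi> \<zeta> = (\<lambda>(x, t). cross3 (\<xi> x) (xi_d \<zeta> x))"

definition signed_area_density ::
  "(real \<times> real \<Rightarrow> real^3) \<Rightarrow> (real \<times> real \<Rightarrow> real^3) \<Rightarrow> real \<times> real \<Rightarrow> real" where
  "signed_area_density F \<nu> p = det (vector [partial_x F p, partial_t F p, \<nu> p] :: real^3^3)"

definition nondegenerate_singular_point ::
  "(real \<times> real \<Rightarrow> real^3) \<Rightarrow> (real \<times> real \<Rightarrow> real^3) \<Rightarrow> real \<times> real \<Rightarrow> bool" where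
  "nondegenerate_singular_point F \<nu> p \<longleftrightarrow>
     singular_point F p \<and> differential (signed_area_density F \<nu>) p \<noteq> (\<lambda>_. 0)"

definition degenerate_singular_point ::
  "(real \<times> real \<Rightarrow> real^3) \<Rightarrow> (real \<times> real \<Rightarrow> real^3) \<Rightarrow> real \<times> real \<Rightarrow> bool" where
  "degenerate_singular_point F \<nu> p \<longleftrightarrow>
     singular_point F p \<and> differential (signed_area_density F \<nu>) p = (\<lambda>_. 0)"

end

theory Submission
  imports Defs "HOL-Complex_Analysis.Complex_Analysis"
begin

text \<open>
  In the frame \<open>\<xi>\<close>, \<open>\<xi>\<^sub>d\<close>, \<open>\<xi> \<times> \<xi>\<^sub>d\<close> one has \<open>F\<^sub>x = p \<xi> + (q + t \<delta>) \<xi>\<^sub>d + r (\<xi> \<times> \<xi>\<^sub>d)\<close> and \<open>F\<^sub>t = \<xi>\<close>.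
  The second fundamental form of a ruled surface has \<open>N = 0\<close>, and \<open>M\<close> is a multiple of \<open>\<delta> r\<close>, so
  developability gives \<open>r x = 0\<close> for \<open>x \<noteq> 0\<close> (choosing a \<open>t\<close> with \<open>q + t \<delta> \<noteq> 0\<close>), and \<open>r 0 = 0\<close> by
  continuity. Hence \<open>(0, t)\<close> is singular iff \<open>q 0 + t \<delta> 0 = 0\<close>, and it is degenerate iff
  moreover \<open>q' 0 + t \<delta>' 0 = 0\<close> and \<open>\<delta> 0 = 0\<close>; both are read off from the orders \<open>Q\<close> and \<open>k\<close>
  of \<open>q\<close> and \<open>\<delta>\<close> at \<open>0\<close>.
\<close>

section \<open>Passage between real and complex power series\<close>

text \<open>The coefficients of \<open>A\<close>, read as complex numbers, give a series with the
  same radius of convergence, which depends only on absolute values. Its sum is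
  \<open>G\<close>.\<close>

lemma has_fps_expansion_complexify:
  fixes g :: "real \<Rightarrow> real"
  assumes "g has_fps_expansion A"
  obtains G where "G analytic_on {0::complex}"
    "\<forall>\<^sub>F x in nhds 0. G (complex_of_real x) = complex_of_real (g x)"
proof
  define B where "B = Abs_fps (\<lambda>n. complex_of_real (fps_nth A n))"
  have rad: "fps_conv_radius B = fps_conv_radius A"
    unfolding fps_conv_radius_def B_def conv_radius_def by simp
  have A: "fps_conv_radius A > 0" "\<forall>\<^sub>F x in nhds 0. eval_fps A x = g x"
    using assms by (auto simp: has_fps_expansion_def)
  show "eval_fps B analytic_on {0}"
    using A(1) rad by (intro analytic_on_eval_fps) (auto simp: zero_ereal_def)
  have "\<forall>\<^sub>F x in nhds (0::real). x \<in> eball 0 (fps_conv_radius A)"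
    using A(1) by (intro eventually_nhds_in_open) (auto simp: zero_ereal_def)
  with A(2) show "\<forall>\<^sub>F x in nhds 0. eval_fps B (complex_of_real x) = complex_of_real (g x)"
  proof eventually_elim
    case (elim x)
    have "(\<lambda>n. fps_nth A n * x ^ n) sums eval_fps A x"
      using elim by (intro sums_eval_fps) auto
    then have "(\<lambda>n. fps_nth B n * complex_of_real x ^ n) sums complex_of_real (eval_fps A x)"
      using bounded_linear.sums[OF bounded_linear_of_real] by (simp add: B_def flip: of_real_power of_real_mult)
    then show ?case
      using elim by (simp add: eval_fps_def sums_iff)
  qed
qed

text \<open>On the real axis the real part of the series is the series of the real parts of the
  coefficients. This allows \<open>G\<close> to have non-real values there.\<close>

lemma has_fps_expansion_real_part:
  fixes g :: "real \<Rightarrow> real"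
  assumes G: "G analytic_on {0::complex}" and g: "\<forall>\<^sub>F x in nhds 0. Re (G (complex_of_real x)) = g x"
  shows "\<exists>A. g has_fps_expansion A"
proof -
  define B where "B = fps_expansion G 0"
  define A where "A = Abs_fps (\<lambda>n. Re (fps_nth B n))"
  have "G has_fps_expansion B"
    unfolding B_def using G by (rule analytic_at_imp_has_fps_expansion_0)
  then have B: "fps_conv_radius B > 0" "\<forall>\<^sub>F z in nhds 0. eval_fps B z = G z"
    by (auto simp: has_fps_expansion_def)
  have sums: "(\<lambda>n. fps_nth A n * x ^ n) sums Re (eval_fps B (complex_of_real x))"
    if "ereal \<bar>x\<bar> < fps_conv_radius B" for x
  proof -
    have "(\<lambda>n. fps_nth B n * complex_of_real x ^ n) sums eval_fps B (complex_of_real x)"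
      using that by (intro sums_eval_fps) auto
    from sums_Re[OF this] show ?thesis
      by (simp add: A_def flip: of_real_power)
  qed
  obtain r where r: "0 < ereal r" "ereal r < fps_conv_radius B"
    using B(1) ereal_dense2 by blast
  \<comment> \<open>Convergence at the single point \<open>r\<close> bounds the radius from
    below.\<close>
  have "ereal (norm r) \<le> fps_conv_radius A"
    unfolding fps_conv_radius_def
    using r sums[of r] by (intro conv_radius_geI) (auto simp: sums_iff)
  then have "fps_conv_radius A > 0"
    using r(1) by (intro less_le_trans[OF r(1)]) auto
  moreover have "\<forall>\<^sub>F x in nhds 0. eval_fps A x = g x"
  proof -
    have lim: "filterlim complex_of_real (nhds 0) (nhds 0)"
      using tendsto_of_real[OF filterlim_ident, of "0::real"] by simp
    have "\<forall>\<^sub>F x in nhds (0::real). eval_fps B (complex_of_real x) = G (complex_of_real x)"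
      by (rule eventually_compose_filterlim[OF B(2) lim])
    moreover have "\<forall>\<^sub>F x in nhds (0::real). x \<in> ball 0 r"
      using r by (intro eventually_nhds_in_open) auto
    ultimately show ?thesis using g
    proof eventually_elim
      case (elim x)
      then have "ereal \<bar>x\<bar> < fps_conv_radius B"
        using r by (auto intro: less_trans[of _ "ereal r"])
      then show ?case
        using sums[of x] elim by (simp add: eval_fps_def sums_iff)
    qed
  qed
  ultimately show ?thesis
    by (auto simp: has_fps_expansion_def)
qed

text \<open>
  The library composes power series only for holomorphic functions; hence the detour through the
  complexification of \<open>g\<close> and the complex square root.
\<close>

lemma has_fps_expansion_inverse_sqrt:
  fixes g :: "real \<Rightarrow> real"
  assumes g: "g has_fps_expansion A" and pos: "g 0 > 0"
  shows "\<exists>B. (\<lambda>x. inverse (sqrt (g x))) has_fps_expansion B"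
proof -
  obtain G where G: "G analytic_on {0::complex}"
    and eq: "\<forall>\<^sub>F x in nhds 0. G (complex_of_real x) = complex_of_real (g x)"
    using has_fps_expansion_complexify[OF g] by blast
  have G0: "G 0 = complex_of_real (g 0)"
    using eventually_nhds_x_imp_x[OF eq] by simp
  \<comment> \<open>As \<open>g 0 > 0\<close>, the value \<open>G 0\<close> lies off the branch cut
    of the square root and is nonzero.\<close>
  have "(\<lambda>z. inverse (csqrt (G z))) analytic_on {0}"
    using G G0 pos by (intro analytic_intros) (auto simp: complex_nonpos_Reals_iff)
  moreover have "isCont g 0"
    using has_fps_expansion_imp_continuous[OF g] .
  then have "\<forall>\<^sub>F x in nhds 0. g x > 0"
    using pos order_tendstoD(1)[of g "g 0" "nhds 0" 0] by (simp add: continuous_at tendsto_at_iff_tendsto_nhds)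
  then have "\<forall>\<^sub>F x in nhds 0. Re (inverse (csqrt (G (complex_of_real x)))) = inverse (sqrt (g x))"
    using eq by eventually_elim (simp add: csqrt_of_real flip: of_real_inverse)
  ultimately show ?thesis
    by (rule has_fps_expansion_real_part)
qed

section \<open>Closure properties and smoothness of real analytic functions\<close>

lemma real_analytic_onD:
  fixes f :: "real \<Rightarrow> 'a::euclidean_space"
  assumes "real_analytic_on f S" "x \<in> S"
  obtains A where "\<And>b. b \<in> Basis \<Longrightarrow> (\<lambda>h. f (x + h) \<bullet> b) has_fps_expansion A b"
  using assms unfolding real_analytic_on_def by metis

lemma real_analytic_on_real_iff:
  fixes f :: "real \<Rightarrow> real"
  shows "real_analytic_on f S \<longleftrightarrow> (\<forall>x\<in>S. \<exists>A. (\<lambda>h. f (x + h)) has_fps_expansion A)"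
  by (simp add: real_analytic_on_def)

text \<open>The squared norm is a sum of squares of analytic components and is positive on
  \<open>S\<close>, so its inverse square root is analytic. This yields analyticity of
  \<open>t(x)\<close>.\<close>

lemma real_analytic_on_inverse_norm:
  fixes f :: "real \<Rightarrow> 'a::euclidean_space"
  assumes f: "real_analytic_on f S" and nz: "\<forall>x\<in>S. f x \<noteq> 0"
  shows "real_analytic_on (\<lambda>x. inverse (norm (f x))) S"
  unfolding real_analytic_on_real_iff
proof
  fix x assume x: "x \<in> S"
  obtain A where A: "\<And>b. b \<in> Basis \<Longrightarrow> (\<lambda>h. f (x + h) \<bullet> b) has_fps_expansion A b"
    using real_analytic_onD[OF f x] by blast
  have "(\<lambda>h. \<Sum>b\<in>Basis. (f (x + h) \<bullet> b) * (f (x + h) \<bullet> b)) has_fps_expansion (\<Sum>b\<in>Basis. A b * A b)"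
    by (intro fps_expansion_intros A)
  also have "(\<lambda>h. \<Sum>b\<in>Basis. (f (x + h) \<bullet> b) * (f (x + h) \<bullet> b)) = (\<lambda>h. f (x + h) \<bullet> f (x + h))"
    by (simp flip: euclidean_inner)
  finally show "\<exists>A. (\<lambda>h. inverse (norm (f (x + h)))) has_fps_expansion A"
    using has_fps_expansion_inverse_sqrt[of "\<lambda>h. f (x + h) \<bullet> f (x + h)"] nz x
    by (simp add: norm_eq_sqrt_inner)
qed

lemma real_analytic_on_mult:
  fixes f g :: "real \<Rightarrow> real"
  assumes "real_analytic_on f S" "real_analytic_on g S"
  shows "real_analytic_on (\<lambda>x. f x * g x) S"
  using assms unfolding real_analytic_on_real_iff by (metis has_fps_expansion_mult)

lemma real_analytic_on_minus:
  fixes f :: "real \<Rightarrow> real"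
  assumes "real_analytic_on f S"
  shows "real_analytic_on (\<lambda>x. - f x) S"
  using assms unfolding real_analytic_on_real_iff by (metis has_fps_expansion_minus)

lemma real_analytic_on_power: "real_analytic_on (\<lambda>x::real. x ^ n) S"
proof -
  have "(\<lambda>h. (x + h) ^ n) has_fps_expansion (\<Prod>i<n. fps_const x + fps_X)" for x :: real
  proof -
    have "(\<lambda>h. \<Prod>i<n. x + h) has_fps_expansion (\<Prod>i<n. fps_const x + fps_X)"
      by (intro fps_expansion_intros)
    then show ?thesis by simp
  qed
  then show ?thesis
    unfolding real_analytic_on_real_iff by blast
qed

text \<open>The componentwise termwise derivative \<open>D\<close> is the derivative at all points
  near \<open>x\<close>, not only at \<open>x\<close>, and \<open>D\<close> is continuous at
  \<open>x\<close> as a sum of power series.\<close>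

lemma real_analytic_on_imp_C1:
  fixes f :: "real \<Rightarrow> 'a::euclidean_space"
  assumes f: "real_analytic_on f S" and x: "x \<in> S"
  shows real_analytic_on_imp_differentiable: "f differentiable at x"
    and real_analytic_on_imp_isCont_vector_derivative: "isCont (\<lambda>y. vector_derivative f (at y)) x"
proof -
  obtain A where A: "\<And>b. b \<in> Basis \<Longrightarrow> (\<lambda>h. f (x + h) \<bullet> b) has_fps_expansion A b"
    using real_analytic_onD[OF f x] by blast
  define D where "D y = (\<Sum>b\<in>Basis. eval_fps (fps_deriv (A b)) (y - x) *\<^sub>R b)" for y
  have component: "\<forall>\<^sub>F y in nhds x. ((\<lambda>y. f y \<bullet> b) has_real_derivative eval_fps (fps_deriv (A b)) (y - x)) (at y)"
    if "b \<in> Basis" for b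
  proof -
    have R: "fps_conv_radius (A b) > 0" "\<forall>\<^sub>F h in nhds 0. eval_fps (A b) h = f (x + h) \<bullet> b"
      using A[OF that] by (auto simp: has_fps_expansion_def)
    have "\<forall>\<^sub>F h in nhds (0::real). h \<in> eball 0 (fps_conv_radius (A b))"
      using R(1) by (intro eventually_nhds_in_open) (auto simp: zero_ereal_def)
    \<comment> \<open>Transferring a derivative at \<open>h\<close> takes agreement on a
      neighbourhood of \<open>h\<close>, not just at \<open>h\<close>.\<close>
    moreover have "\<forall>\<^sub>F h in nhds 0. \<forall>\<^sub>F h' in nhds h. eval_fps (A b) h' = f (x + h') \<bullet> b"
      using R(2) by (simp add: eventually_eventually)
    ultimately have "\<forall>\<^sub>F h in nhds 0. ((\<lambda>h. f (x + h) \<bullet> b) has_real_derivative eval_fps (fps_deriv (A b)) h) (at h)"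
    proof eventually_elim
      case (elim h)
      have "(eval_fps (A b) has_field_derivative eval_fps (fps_deriv (A b)) h) (at h)"
        using elim by (intro has_field_derivative_eval_fps) auto
      then show ?case
        using DERIV_cong_ev[OF refl elim(2) refl] by blast
    qed
    then have "\<forall>\<^sub>F y in nhds x. ((\<lambda>h. f (x + h) \<bullet> b) has_real_derivative eval_fps (fps_deriv (A b)) (y - x)) (at (y - x))"
      by (rule eventually_compose_filterlim) (auto intro!: tendsto_eq_intros filterlim_ident)
    then show ?thesis
    proof eventually_elim
      case (elim y)
      then show ?case
        using DERIV_shift[of "\<lambda>y. f y \<bullet> b" _ "y - x" x] by (simp add: add.commute)
    qed
  qed
  have "\<forall>\<^sub>F y in nhds x. \<forall>b\<in>Basis. ((\<lambda>y. f y \<bullet> b) has_real_derivative eval_fps (fps_deriv (A b)) (y - x)) (at y)"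
    using component by (intro eventually_ball_finite) auto
  then have deriv: "\<forall>\<^sub>F y in nhds x. (f has_vector_derivative D y) (at y)"
  proof eventually_elim
    case (elim y)
    have "((\<lambda>y. \<Sum>b\<in>Basis. (f y \<bullet> b) *\<^sub>R b) has_vector_derivative D y) (at y)"
      unfolding D_def using elim
      by (intro has_vector_derivative_sum) (auto intro!: derivative_eq_intros)
    then show ?case
      by (simp add: euclidean_representation)
  qed
  show "f differentiable at x"
    using eventually_nhds_x_imp_x[OF deriv] by (rule differentiableI_vector)
  have "isCont D x"
    unfolding D_def
  proof (intro continuous_intros)
    fix b :: 'a assume b: "b \<in> Basis"
    have "eval_fps (fps_deriv (A b)) has_fps_expansion fps_deriv (A b)"
      using A[OF b] by (intro eval_fps_has_fps_expansion)
        (auto simp: has_fps_expansion_def intro: less_le_trans[OF _ fps_conv_radius_deriv])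
    then have "isCont (eval_fps (fps_deriv (A b))) (x - x)"
      unfolding diff_self by (rule has_fps_expansion_imp_continuous)
    then show "isCont (\<lambda>y. eval_fps (fps_deriv (A b)) (y - x)) x"
      by (rule isCont_o2[rotated]) simp
  qed
  moreover have "\<forall>\<^sub>F y in nhds x. vector_derivative f (at y) = D y"
    using deriv by eventually_elim (rule vector_derivative_at)
  ultimately show "isCont (\<lambda>y. vector_derivative f (at y)) x"
    by (simp add: isCont_cong)
qed

section \<open>Singular points and curvature of ruled surfaces\<close>

text \<open>Adjoining \<open>0\<close> turns dimension into affine dimension, and a vanishing cross
  product means that \<open>0\<close>, \<open>a\<close>, \<open>b\<close> are collinear.\<close>

lemma dim_doubleton_less_2_iff:
  fixes a b :: "real^3"
  shows "dim {a, b} < 2 \<longleftrightarrow> cross3 a b = 0"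
proof -
  have "aff_dim {0, a, b} = int (dim {0, a, b})"
    by (rule aff_dim_zero) (simp add: hull_inc)
  also have "dim {0, a, b} = dim {a, b}"
    using dim_span[of "{0, a, b}"] dim_span[of "{a, b}"] by simp
  finally show ?thesis
    by (auto simp: cross_eq_0 collinear_aff_dim)
qed

lemma has_derivative_ruled_surface:
  assumes "(\<gamma> has_vector_derivative a) (at x)" "(\<xi> has_vector_derivative b) (at x)"
  shows "(ruled_surface \<gamma> \<xi> has_derivative
           (\<lambda>h. fst h *\<^sub>R (a + t *\<^sub>R b) + snd h *\<^sub>R \<xi> x)) (at (x, t))"
proof -
  have fst': "((\<lambda>p. f (fst p)) has_derivative (\<lambda>h. fst h *\<^sub>R c)) (at (x, t))"
    if "(f has_vector_derivative c) (at x)" for f :: "real \<Rightarrow> real^3" and c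
    using has_derivative_compose[OF has_derivative_fst[OF has_derivative_ident], of f _ "(x, t)" UNIV] that
    by (simp add: has_vector_derivative_def)
  have "((\<lambda>p. \<gamma> (fst p) + snd p *\<^sub>R \<xi> (fst p)) has_derivative
           (\<lambda>h. fst h *\<^sub>R (a + t *\<^sub>R b) + snd h *\<^sub>R \<xi> x)) (at (x, t))"
    by (rule has_derivative_eq_rhs[OF has_derivative_add[OF fst'[OF assms(1)]
          has_derivative_scaleR[OF has_derivative_snd[OF has_derivative_ident] fst'[OF assms(2)]]]])
       (simp add: algebra_simps)
  then show ?thesis
    by (simp add: ruled_surface_def case_prod_unfold)
qed

lemma partial_x_ruled_surface:
  assumes "(\<gamma> has_vector_derivative a) (at x)" "(\<xi> has_vector_derivative b) (at x)"
  shows "partial_x (ruled_surface \<gamma> \<xi>) (x, t) = a + t *\<^sub>R b"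
  unfolding partial_x_def ruled_surface_def
  by (auto intro!: vector_derivative_at derivative_eq_intros assms)

lemma partial_t_ruled_surface: "partial_t (ruled_surface \<gamma> \<xi>) (x, t) = \<xi> x"
  unfolding partial_t_def ruled_surface_def
  by (auto intro!: vector_derivative_at derivative_eq_intros)

lemma singular_point_ruled_surface_iff:
  assumes "(\<gamma> has_vector_derivative a) (at x)" "(\<xi> has_vector_derivative b) (at x)"
  shows "singular_point (ruled_surface \<gamma> \<xi>) (x, t) \<longleftrightarrow> cross3 (a + t *\<^sub>R b) (\<xi> x) = 0"
proof -
  let ?a = "a + t *\<^sub>R b"
  have "range (differential (ruled_surface \<gamma> \<xi>) (x, t)) = range (\<lambda>h. fst h *\<^sub>R ?a + snd h *\<^sub>R \<xi> x)"
    by (simp add: differential_def flip: frechet_derivative_at[OF has_derivative_ruled_surface[OF assms]])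
  also have "\<dots> = span {?a, \<xi> x}"
  proof (rule set_eqI)
    fix v
    have "v \<in> span {?a, \<xi> x} \<longleftrightarrow> (\<exists>k l. v = k *\<^sub>R ?a + l *\<^sub>R \<xi> x)"
      unfolding span_breakdown_eq span_singleton by (simp add: image_iff diff_eq_eq add.commute)
    then show "v \<in> range (\<lambda>h. fst h *\<^sub>R ?a + snd h *\<^sub>R \<xi> x) \<longleftrightarrow> v \<in> span {?a, \<xi> x}"
      by (simp add: image_iff)
  qed
  finally show ?thesis
    unfolding singular_point_def by (simp add: dim_doubleton_less_2_iff)
qed

text \<open>Since \<open>N = 0\<close>, zero curvature forces \<open>M = 0\<close>, where
  \<open>M\<close> is \<open>b\<close> paired with the normal. The part \<open>t *\<^sub>R b\<close>
  of \<open>F_x\<close> contributes nothing, as \<open>b\<close> is orthogonal to its own cross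
  products, so the conclusion is free of \<open>t\<close>.\<close>

lemma gaussian_curvature_ruled_surface_eq_0:
  assumes deriv: "(\<gamma> has_vector_derivative a) (at x)" "(\<xi> has_vector_derivative b) (at x)"
    and regular: "\<not> singular_point (ruled_surface \<gamma> \<xi>) (x, t)"
    and zero: "gaussian_curvature (ruled_surface \<gamma> \<xi>) (x, t) = 0"
  shows "b \<bullet> cross3 a (\<xi> x) = 0"
proof -
  define c where "c = cross3 (a + t *\<^sub>R b) (\<xi> x)"
  have c: "c \<noteq> 0"
    using regular singular_point_ruled_surface_iff[OF deriv] by (simp add: c_def)
  have M: "partial_x (partial_t (ruled_surface \<gamma> \<xi>)) (x, t) = b"
    unfolding partial_x_def partial_t_ruled_surface using deriv(2)
    by (simp add: vector_derivative_at partial_t_ruled_surface)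
  have N: "partial_t (partial_t (ruled_surface \<gamma> \<xi>)) (x, t) = 0"
    unfolding partial_t_def[of "partial_t _"] by (simp add: partial_t_ruled_surface)
  \<comment> \<open>Lagrange's identity: the denominator of the curvature is nonzero at a regular
    point, so the numerator must vanish.\<close>
  have "((a + t *\<^sub>R b) \<bullet> (a + t *\<^sub>R b)) * (\<xi> x \<bullet> \<xi> x) - ((a + t *\<^sub>R b) \<bullet> \<xi> x)\<^sup>2 = (norm c)\<^sup>2"
    unfolding c_def norm_cross by (simp add: power2_norm_eq_inner power_mult_distrib)
  with zero c have "b \<bullet> c = 0"
    by (simp add: gaussian_curvature_def Let_def M N partial_t_ruled_surface
        partial_x_ruled_surface[OF deriv] flip: c_def)
  moreover have "b \<bullet> c = b \<bullet> cross3 a (\<xi> x)"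
    by (simp add: c_def cross_add_left cross_mult_left inner_add_right dot_cross_self)
  ultimately show ?thesis by simp
qed

section \<open>Frame computations and derivatives at \<open>0\<close>\<close>

lemma cross3_frame_left:
  assumes "norm u = 1" "u \<bullet> w = 0"
  shows "cross3 (p *\<^sub>R u + A *\<^sub>R w + r *\<^sub>R cross3 u w) u = r *\<^sub>R w - A *\<^sub>R cross3 u w"
proof -
  have "cross3 (cross3 u w) u = w"
    unfolding cross_skew[of "cross3 u w" u] using assms by (simp add: Lagrange norm_eq_1)
  then show ?thesis
    by (simp add: cross_add_left cross_mult_left cross_skew[of w u])
qed

lemma det_frame:
  assumes "norm u = 1" "norm w = 1" "u \<bullet> w = 0"
  shows "det (vector [p *\<^sub>R u + A *\<^sub>R w + r *\<^sub>R cross3 u w, u, cross3 u w] :: real^3^3) = - A"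
proof -
  have "cross3 u (cross3 u w) = - w"
    using assms by (simp add: Lagrange norm_eq_1)
  then show ?thesis
    using assms by (simp add: inner_add_left dot_cross_self norm_eq_1 flip: dot_cross_det)
qed

text \<open>For \<open>n \<ge> 1\<close> the product rule term with \<open>f'\<close> carries the
  factor \<open>0 ^ n = 0\<close>, so only the value \<open>f 0\<close> can survive, and only if
  \<open>n = 1\<close>. For \<open>n = 0\<close> just the existence of \<open>D\<close> is
  claimed.\<close>

lemma has_real_derivative_mult_power_at_0:
  fixes f :: "real \<Rightarrow> real"
  assumes "f differentiable at 0"
  obtains D where "((\<lambda>x. f x * x ^ n) has_real_derivative D) (at 0)"
    "n \<ge> 1 \<longrightarrow> D = (if n = 1 then f 0 else 0)"
proof -
  obtain f' where f': "(f has_real_derivative f') (at 0)"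
    using assms real_differentiable_def by blast
  show thesis
  proof
    show "((\<lambda>x. f x * x ^ n) has_real_derivative (f 0 * (real n * 0 ^ (n - 1)) + f' * 0 ^ n)) (at 0)"
      by (auto intro!: derivative_eq_intros f')
    show "n \<ge> 1 \<longrightarrow> f 0 * (real n * 0 ^ (n - 1)) + f' * 0 ^ n = (if n = 1 then f 0 else 0)"
      by (auto simp: power_0_left)
  qed
qed

lemma cross3_orthonormal_inner_self:
  assumes "norm u = 1" "norm w = 1" "u \<bullet> w = 0"
  shows "cross3 u w \<bullet> cross3 u w = 1"
  using assms by (simp add: dot_cross norm_eq_1)

text \<open>Pairing the cross product with \<open>cross3 u w\<close> and with \<open>w\<close>
  recovers \<open>- A\<close> and \<open>r\<close>.\<close>

lemma cross3_frame_left_eq_0_iff: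
  assumes "norm u = 1" "norm w = 1" "u \<bullet> w = 0"
  shows "cross3 (p *\<^sub>R u + A *\<^sub>R w + r *\<^sub>R cross3 u w) u = 0 \<longleftrightarrow> A = 0 \<and> r = 0"
proof -
  let ?c = "r *\<^sub>R w - A *\<^sub>R cross3 u w"
  have "cross3 u w \<bullet> ?c = - A" "w \<bullet> ?c = r"
    using assms cross3_orthonormal_inner_self[OF assms]
    by (simp_all add: inner_diff_right dot_cross_self norm_eq_1)
  then have "A = 0 \<and> r = 0" if "?c = 0"
    unfolding that by simp
  then show ?thesis
    unfolding cross3_frame_left[OF assms(1,3)] by auto
qed

text \<open>Serves to extend identities to \<open>0\<close> that are obtained elsewhere by
  cancelling \<open>\<delta>\<close>, which vanishes at \<open>0\<close> when
  \<open>k > 0\<close>.\<close>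

lemma isCont_eq_0:
  fixes f :: "real \<Rightarrow> real"
  assumes "isCont f a" "open I" "a \<in> I" "\<And>x. x \<in> I \<Longrightarrow> x \<noteq> a \<Longrightarrow> f x = 0"
  shows "f a = 0"
proof -
  have "\<forall>\<^sub>F x in at a. f x = 0"
    using assms(2-4) by (auto simp: eventually_at_topological)
  then have "(f \<longlongrightarrow> 0) (at a)"
    by (rule tendsto_eventually)
  then show ?thesis
    using assms(1) LIM_unique unfolding isCont_def by blast
qed

text \<open>The partial derivatives at \<open>(0, t)\<close> are \<open>- (f' + t * g')\<close> and
  \<open>- g 0\<close>. The formula for \<open>F\<close> holds on the open strip
  \<open>I \<times> UNIV\<close>, which is enough for the differential.\<close>

lemma differential_affine_in_t:
  fixes f g :: "real \<Rightarrow> real"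
  assumes f: "(f has_real_derivative f') (at 0)" and g: "(g has_real_derivative g') (at 0)"
    and F: "open I" "0 \<in> I" "\<And>x t. x \<in> I \<Longrightarrow> F (x, t) = - (f x + t * g x)"
  shows "differential F (0, t) = (\<lambda>_. 0) \<longleftrightarrow> f' + t * g' = 0 \<and> g 0 = 0"
proof -
  have fst': "((\<lambda>p. h (fst p)) has_derivative (\<lambda>v. h' * fst v)) (at (0, t))"
    if "(h has_real_derivative h') (at 0)" for h :: "real \<Rightarrow> real" and h'
    using has_derivative_compose[OF has_derivative_fst[OF has_derivative_ident], of h _ "(0, t)" UNIV] that
    by (simp add: has_field_derivative_def)
  have "((\<lambda>p. - (f (fst p) + snd p * g (fst p))) has_derivative
      (\<lambda>v. - ((f' + t * g') * fst v + g 0 * snd v))) (at (0, t))"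
    by (rule has_derivative_eq_rhs[OF has_derivative_minus[OF has_derivative_add[OF fst'[OF f]
          has_derivative_mult[OF has_derivative_snd[OF has_derivative_ident] fst'[OF g]]]]])
       (simp add: algebra_simps)
  then have "(F has_derivative (\<lambda>v. - ((f' + t * g') * fst v + g 0 * snd v))) (at (0, t))"
    by (rule has_derivative_transform_within_open[of _ _ _ _ "I \<times> UNIV"])
       (use F in \<open>auto simp: open_Times\<close>)
  then have D: "differential F (0, t) = (\<lambda>v. - ((f' + t * g') * fst v + g 0 * snd v))"
    unfolding differential_def by (rule frechet_derivative_at[symmetric])
  show ?thesis
  proof
    assume "differential F (0, t) = (\<lambda>_. 0)"
    then have "- ((f' + t * g') * fst v + g 0 * snd v) = 0" for v
      unfolding D by (rule fun_cong)
    from this[of "(1, 0)"] this[of "(0, 1)"] show "f' + t * g' = 0 \<and> g 0 = 0"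
      by simp
  qed (simp add: D)
qed

section \<open>Degeneracy of the singular points over \<open>x = 0\<close>\<close>

theorem proposition3p8:
  fixes I :: "real set" and \<gamma> \<xi> \<zeta> :: "real \<Rightarrow> real^3"
    and p q r qt :: "real \<Rightarrow> real" and k Q :: nat
  assumes I: "open I" "is_interval I" "0 \<in> I"
    and \<gamma>: "real_analytic_on \<gamma> I" "\<gamma> 0 = 0"
    and \<xi>: "real_analytic_on \<xi> I" "\<xi> ` I \<subseteq> sphere 0 1"
    and \<zeta>: "pseudo_cylindrical I k \<xi> \<zeta>"
    and developable: "developable_on I (ruled_surface \<gamma> \<xi>)"
    and frame: "\<forall>x\<in>I. vector_derivative \<gamma> (at x) =
      p x *\<^sub>R \<xi> x + q x *\<^sub>R xi_d \<zeta> x + r x *\<^sub>R cross3 (\<xi> x) (xi_d \<zeta> x)"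
    and q: "real_analytic_on qt I" "\<forall>x\<in>I. q x = qt x * x ^ Q" "k \<ge> Q \<longrightarrow> qt 0 \<noteq> 0"
  shows "(k > Q \<and> Q \<ge> 1 \<longrightarrow>
      (\<forall>t. singular_point (ruled_surface \<gamma> \<xi>) (0, t) \<and>
        (nondegenerate_singular_point (ruled_surface \<gamma> \<xi>) (unit_normal \<xi> \<zeta>) (0, t) \<longleftrightarrow> Q = 1))) \<and>
    (Q \<ge> k \<longrightarrow>
      (let t = (\<lambda>x. - (qt x / norm (\<zeta> x)) * x ^ (Q - k)) in
        real_analytic_on t I \<and> (\<forall>x\<in>I - {0}. t x = - q x / delta \<xi> \<zeta> x) \<and>
        singular_point (ruled_surface \<gamma> \<xi>) (0, t 0) \<and>
        (nondegenerate_singular_point (ruled_surface \<gamma> \<xi>) (unit_normal \<xi> \<zeta>) (0, t 0)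
          \<longleftrightarrow> delta \<xi> \<zeta> 0 \<noteq> 0) \<and>
        (degenerate_singular_point (ruled_surface \<gamma> \<xi>) (unit_normal \<xi> \<zeta>) (0, t 0)
          \<longleftrightarrow> delta \<xi> \<zeta> 0 = 0)))"
proof -
  let ?F = "ruled_surface \<gamma> \<xi>"
  let ?dens = "signed_area_density ?F (unit_normal \<xi> \<zeta>)"
  let ?n = "\<lambda>x. cross3 (\<xi> x) (xi_d \<zeta> x)"
  have \<zeta>_an: "real_analytic_on \<zeta> I" and \<xi>': "\<And>x. x \<in> I \<Longrightarrow> vector_derivative \<xi> (at x) = x ^ k *\<^sub>R \<zeta> x"
    and \<zeta>_nz: "\<And>x. x \<in> I \<Longrightarrow> \<zeta> x \<noteq> 0"
    using \<zeta> by (auto simp: pseudo_cylindrical_def)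
  have \<zeta>_eq: "\<zeta> x = norm (\<zeta> x) *\<^sub>R xi_d \<zeta> x" and norm_xi_d: "norm (xi_d \<zeta> x) = 1" if "x \<in> I" for x
    using \<zeta>_nz[OF that] by (simp_all add: xi_d_def)
  have \<delta>_eq: "delta \<xi> \<zeta> x = norm (\<zeta> x) * x ^ k" if "x \<in> I" for x
    using \<xi>'[OF that] \<zeta>_nz[OF that]
    by (simp add: delta_def xi_d_def dot_square_norm power2_eq_square)
  have D\<gamma>: "(\<gamma> has_vector_derivative p x *\<^sub>R \<xi> x + q x *\<^sub>R xi_d \<zeta> x + r x *\<^sub>R ?n x) (at x)" if "x \<in> I" for x
    using real_analytic_on_imp_differentiable[OF \<gamma>(1) that] frame that by (simp add: vector_derivative_works)
  have D\<xi>: "(\<xi> has_vector_derivative delta \<xi> \<zeta> x *\<^sub>R xi_d \<zeta> x) (at x)" if "x \<in> I" for x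
    using real_analytic_on_imp_differentiable[OF \<xi>(1) that] \<xi>'[OF that] \<delta>_eq[OF that] \<zeta>_eq[OF that]
    by (metis mult.commute scaleR_scaleR vector_derivative_works)
  have norm_\<xi>: "norm (\<xi> x) = 1" if "x \<in> I" for x
    using \<xi>(2) that by auto
  have cont: "isCont \<xi> 0" "isCont \<zeta> 0"
    using real_analytic_on_imp_differentiable[OF \<xi>(1) I(3)] real_analytic_on_imp_differentiable[OF \<zeta>_an I(3)]
    by (auto intro: differentiable_imp_continuous_within)
  then have cont_xi_d: "isCont (xi_d \<zeta>) 0"
    unfolding xi_d_def[abs_def] using \<zeta>_nz[OF I(3)] by (intro continuous_intros) auto

  \<comment> \<open>Differentiating the constant \<open>\<xi> \<bullet> \<xi> = 1\<close> gives
    orthogonality up to the factor \<open>\<delta>\<close>, which is nonzero off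
    \<open>0\<close>.\<close>
  have orth_nz: "\<xi> x \<bullet> xi_d \<zeta> x = 0" if "x \<in> I" "x \<noteq> 0" for x
  proof -
    have "((\<lambda>y. \<xi> y \<bullet> \<xi> y) has_vector_derivative 2 * (\<xi> x \<bullet> (delta \<xi> \<zeta> x *\<^sub>R xi_d \<zeta> x))) (at x)"
      using bounded_bilinear.has_vector_derivative[OF bounded_bilinear_inner D\<xi>[OF that(1)] D\<xi>[OF that(1)]]
      by (simp add: inner_commute)
    moreover have "((\<lambda>y. \<xi> y \<bullet> \<xi> y) has_vector_derivative 0) (at x)"
      by (rule has_vector_derivative_transform_within_open[of "\<lambda>_. 1" _ _ I])
         (use I that norm_\<xi> in \<open>auto simp: norm_eq_1\<close>)
    ultimately have "delta \<xi> \<zeta> x * (\<xi> x \<bullet> xi_d \<zeta> x) = 0"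
      using vector_derivative_unique_at by fastforce
    then show ?thesis
      using \<delta>_eq[OF that(1)] \<zeta>_nz[OF that(1)] that(2) by simp
  qed
  have "isCont (\<lambda>x. \<xi> x \<bullet> xi_d \<zeta> x) 0"
    using cont cont_xi_d by (intro continuous_intros)
  from isCont_eq_0[OF this I(1,3) orth_nz] have orth: "\<xi> x \<bullet> xi_d \<zeta> x = 0" if "x \<in> I" for x
    using orth_nz that by blast

  have F_x: "p x *\<^sub>R \<xi> x + q x *\<^sub>R xi_d \<zeta> x + r x *\<^sub>R ?n x + t *\<^sub>R delta \<xi> \<zeta> x *\<^sub>R xi_d \<zeta> x
      = p x *\<^sub>R \<xi> x + (q x + t * delta \<xi> \<zeta> x) *\<^sub>R xi_d \<zeta> x + r x *\<^sub>R ?n x" for x t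
    by (simp add: algebra_simps)
  have singular_r: "singular_point ?F (x, t) \<longleftrightarrow> q x + t * delta \<xi> \<zeta> x = 0 \<and> r x = 0" if "x \<in> I" for x t
    unfolding singular_point_ruled_surface_iff[OF D\<gamma>[OF that] D\<xi>[OF that]] F_x
    using that by (intro cross3_frame_left_eq_0_iff norm_\<xi> norm_xi_d orth)

  have r_nz: "r x = 0" if "x \<in> I" "x \<noteq> 0" for x
  proof -
    have \<delta>: "delta \<xi> \<zeta> x \<noteq> 0"
      using \<delta>_eq \<zeta>_nz that by simp
    \<comment> \<open>Chosen so that \<open>q + t \<delta> = 1\<close>, which makes
      \<open>(x, t)\<close> regular whatever \<open>r x\<close> is.\<close>
    define t where "t = (1 - q x) / delta \<xi> \<zeta> x"
    have regular: "\<not> singular_point ?F (x, t)"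
      using singular_r[OF that(1)] \<delta> by (simp add: t_def)
    then have "gaussian_curvature ?F (x, t) = 0"
      using developable that(1) by (auto simp: developable_on_def)
    from gaussian_curvature_ruled_surface_eq_0[OF D\<gamma>[OF that(1)] D\<xi>[OF that(1)] regular this]
    have "delta \<xi> \<zeta> x * r x = 0"
      unfolding cross3_frame_left[OF norm_\<xi>[OF that(1)] orth[OF that(1)]]
      using norm_xi_d[OF that(1)] by (auto simp: inner_diff_right dot_cross_self)
    then show ?thesis
      using \<delta> by simp
  qed
  \<comment> \<open>Continuity of \<open>r\<close> is not assumed; it is read off at
    \<open>0\<close> from this expression for \<open>r\<close> on \<open>I\<close>, as
    \<open>\<gamma>\<close> is continuously differentiable.\<close>
  have r_eq: "vector_derivative \<gamma> (at x) \<bullet> ?n x = r x" if "x \<in> I" for x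
    using frame that cross3_orthonormal_inner_self[OF norm_\<xi>[OF that] norm_xi_d[OF that] orth[OF that]]
    by (simp add: inner_add_left dot_cross_self)
  have "isCont (\<lambda>x. vector_derivative \<gamma> (at x) \<bullet> ?n x) 0"
    using real_analytic_on_imp_isCont_vector_derivative[OF \<gamma>(1) I(3)] cont cont_xi_d
    by (intro continuous_intros continuous_cross)
  from isCont_eq_0[OF this I(1,3)] have "r 0 = 0"
    using r_eq r_nz I(3) by simp
  then have singular: "singular_point ?F (0, t) \<longleftrightarrow> q 0 + t * delta \<xi> \<zeta> 0 = 0" for t
    using singular_r I(3) by simp

  have "?dens (x, t) = - (q x + t * delta \<xi> \<zeta> x)" if "x \<in> I" for x t
    unfolding signed_area_density_def partial_x_ruled_surface[OF D\<gamma>[OF that] D\<xi>[OF that]]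
      partial_t_ruled_surface F_x unit_normal_def prod.case
    using that by (intro det_frame norm_\<xi> norm_xi_d orth)
  then have dens: "?dens (x, t) = - (qt x * x ^ Q + t * (norm (\<zeta> x) * x ^ k))" if "x \<in> I" for x t
    using q(2) \<delta>_eq that by simp
  obtain q' where q': "((\<lambda>x. qt x * x ^ Q) has_real_derivative q') (at 0)"
    and q'_eq: "Q \<ge> 1 \<longrightarrow> q' = (if Q = 1 then qt 0 else 0)"
    using has_real_derivative_mult_power_at_0 real_analytic_on_imp_differentiable[OF q(1) I(3)] by blast
  have "(\<lambda>x. norm (\<zeta> x)) differentiable at 0"
    using real_analytic_on_imp_differentiable[OF \<zeta>_an I(3)] \<zeta>_nz[OF I(3)]
    by (intro differentiable_compose[of norm \<zeta>] differentiable_norm_at)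
  then obtain \<delta>' where \<delta>': "((\<lambda>x. norm (\<zeta> x) * x ^ k) has_real_derivative \<delta>') (at 0)"
    and \<delta>'_eq: "k \<ge> 1 \<longrightarrow> \<delta>' = (if k = 1 then norm (\<zeta> 0) else 0)"
    using has_real_derivative_mult_power_at_0 by blast
  \<comment> \<open>The second condition is the vanishing of the \<open>t\<close>-derivative of the
    density, which is \<open>- \<delta>(0)\<close>.\<close>
  have d_dens: "differential ?dens (0, t) = (\<lambda>_. 0) \<longleftrightarrow> q' + t * \<delta>' = 0 \<and> delta \<xi> \<zeta> 0 = 0" for t
    using differential_affine_in_t[OF q' \<delta>' I(1,3) dens] \<delta>_eq[OF I(3)] by simp
  have q0: "q 0 = qt 0 * 0 ^ Q" and \<delta>0: "delta \<xi> \<zeta> 0 = norm (\<zeta> 0) * 0 ^ k" and \<zeta>0: "\<zeta> 0 \<noteq> 0"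
    using q(2) \<delta>_eq I(3) \<zeta>_nz by auto

  show ?thesis
  proof (intro conjI impI allI)
    fix t assume kQ: "k > Q \<and> Q \<ge> 1"
    then show sing: "singular_point ?F (0, t)"
      by (auto simp: singular q0 \<delta>0 power_0_left)
    \<comment> \<open>Here \<open>k \<ge> 2\<close>, so \<open>\<delta>(0)\<close> and
      \<open>\<delta>'\<close> vanish and only \<open>q'\<close> decides. It equals
      \<open>qt 0 \<noteq> 0\<close> for \<open>Q = 1\<close> and \<open>0\<close> for larger
      \<open>Q\<close>.\<close>
    show "nondegenerate_singular_point ?F (unit_normal \<xi> \<zeta>) (0, t) \<longleftrightarrow> Q = 1"
      using kQ sing q(3) q'_eq \<delta>'_eq by (auto simp: nondegenerate_singular_point_def d_dens \<delta>0)
  next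
    assume kQ: "Q \<ge> k"
    define t where "t x = - (qt x / norm (\<zeta> x)) * x ^ (Q - k)" for x
    have "real_analytic_on (\<lambda>x. - (qt x * inverse (norm (\<zeta> x))) * x ^ (Q - k)) I"
      using q(1) \<zeta>_an \<zeta>_nz
      by (intro real_analytic_on_mult real_analytic_on_minus real_analytic_on_power
          real_analytic_on_inverse_norm) auto
    then have t_an: "real_analytic_on t I"
      unfolding t_def[abs_def] by (simp add: divide_inverse)
    have t_eq: "t x = - q x / delta \<xi> \<zeta> x" if "x \<in> I - {0}" for x
      using that q(2) \<delta>_eq kQ \<zeta>_nz by (simp add: t_def power_diff)
    \<comment> \<open>With \<open>0 ^ 0 = 1\<close>, the value \<open>t 0\<close> is
      \<open>- qt 0 / norm (\<zeta> 0)\<close> if \<open>Q = k\<close> and \<open>0\<close> if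
      \<open>Q > k\<close>. The terms cancel for \<open>Q = k = 0\<close>; in all other cases both
      are zero.\<close>
    have sing: "singular_point ?F (0, t 0)"
      using kQ \<zeta>0 by (auto simp: singular q0 \<delta>0 t_def power_0_left)
    \<comment> \<open>The \<open>x\<close>-derivative vanishes automatically once
      \<open>k \<ge> 1\<close>: for \<open>Q = k = 1\<close> the terms \<open>qt 0\<close> and
      \<open>- qt 0\<close> cancel, for \<open>Q > k = 1\<close> both \<open>q'\<close> and
      \<open>t 0\<close> are zero, and for \<open>k \<ge> 2\<close> both \<open>q'\<close> and
      \<open>\<delta>'\<close> are zero.\<close>
    have "q' + t 0 * \<delta>' = 0" if "delta \<xi> \<zeta> 0 = 0"
    proof -
      have "k \<ge> 1"
        using that \<zeta>0 by (cases k) (auto simp: \<delta>0)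
      then show ?thesis
        using kQ \<zeta>0 q'_eq \<delta>'_eq by (auto simp: t_def power_0_left)
    qed
    then have "differential ?dens (0, t 0) = (\<lambda>_. 0) \<longleftrightarrow> delta \<xi> \<zeta> 0 = 0"
      using d_dens by blast
    with t_an t_eq sing show "let t = (\<lambda>x. - (qt x / norm (\<zeta> x)) * x ^ (Q - k)) in
        real_analytic_on t I \<and> (\<forall>x\<in>I - {0}. t x = - q x / delta \<xi> \<zeta> x) \<and>
        singular_point ?F (0, t 0) \<and>
        (nondegenerate_singular_point ?F (unit_normal \<xi> \<zeta>) (0, t 0) \<longleftrightarrow> delta \<xi> \<zeta> 0 \<noteq> 0) \<and>
        (degenerate_singular_point ?F (unit_normal \<xi> \<zeta>) (0, t 0) \<longleftrightarrow> delta \<xi> \<zeta> 0 = 0)"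
      unfolding Let_def t_def[abs_def]
      by (simp add: nondegenerate_singular_point_def degenerate_singular_point_def)
  qed
qed

end
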